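(* Let $q$ be an odd prime power. The branching matrix of the group $UT_3(\mathbf{F}_q)$ of upper unitriangular $3\times 3$ matrices, with types written in the order $\{C,R\}$, is $$B_{UT_3(\mathbf{F}_q)}=\begin{pmatrix} q&0\\ q^2-1&q^2\end{pmatrix}.$$ In particular every commuting tuple of elements of $UT_3(\mathbf{F}_q)$ has one of these two types.
   Context: $\mathbf{F}_q$ is the finite field with $q$ elements, $q$ odd. For a finite group $G$ and a commuting tuple $(g_1,\dots,g_k)$ of elements of $G$ ($k\ge 1$), $Z_G(g_1,\dots,g_k)$ denotes its simultaneous centralizer in $G$. Two commuting tuples (possibly of different lengths) are of the same type if their simultaneous centralizers are isomorphic groups. If $(g_1,\dots,g_k)$ is a commuting tuple with $Z=Z_G(g_1,\dots,g_k)$, a branch of it is a $Z$-conjugacy class of elements $h\in Z$; the type of the branch is the type of the tuple $(g_1,\dots,g_k,h)$, i.e. it is determined by the centralizer $Z_Z(h)$. The branching matrix $B_G$ has rows and columns indexed by the types of commuting tuples; its entry in row $s$, column $t$ is the number of branches of type $s$ of any commuting tuple of type $t$. Types for $G=UT_3(\mathbf{F}_q)$ (given by the isomorphism class of the centralizer): $C$: the whole group $UT_3(\mathbf{F}_q)$ (central elements); $R$: the commutative group $\left\{\begin{pmatrix}1&x_0&x_1\\0&1&0\\0&0&1\end{pmatrix}: x_0,x_1\in\mathbf{F}_q\right\}$ of order $q^2$. *)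

theory Defs
  imports "HOL-Analysis.Analysis" "HOL-Algebra.Group_Action"
begin

section \<open>Types of commuting tuples and the branching matrix of a group\<close>

definition commuting_tuples :: "('a, 'b) monoid_scheme \<Rightarrow> 'a list set" where
  "commuting_tuples G = {gs. gs \<noteq> [] \<and> set gs \<subseteq> carrier G \<and>
     (\<forall>x\<in>set gs. \<forall>y\<in>set gs. x \<otimes>\<^bsub>G\<^esub> y = y \<otimes>\<^bsub>G\<^esub> x)}"

definition centralizer :: "('a, 'b) monoid_scheme \<Rightarrow> 'a list \<Rightarrow> ('a, 'b) monoid_scheme" where
  "centralizer G gs =
     G\<lparr>carrier := {z \<in> carrier G. \<forall>g\<in>set gs. z \<otimes>\<^bsub>G\<^esub> g = g \<otimes>\<^bsub>G\<^esub> z}\<rparr>"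

text \<open>A type is represented by the set of all commuting tuples (of any positive length) of that
  type. The type given by the isomorphism class of a group \<open>H\<close> is empty if \<open>H\<close> is not isomorphic
  to the centralizer of a commuting tuple.\<close>

definition type_given_by ::
    "('a, 'b) monoid_scheme \<Rightarrow> ('c, 'd) monoid_scheme \<Rightarrow> 'a list set" where
  "type_given_by G H = {gs \<in> commuting_tuples G. centralizer G gs \<cong> H}"

definition type_of_tuple :: "('a, 'b) monoid_scheme \<Rightarrow> 'a list \<Rightarrow> 'a list set" where
  "type_of_tuple G gs = type_given_by G (centralizer G gs)"

definition tuple_types :: "('a, 'b) monoid_scheme \<Rightarrow> 'a list set set" where
  "tuple_types G = type_of_tuple G ` commuting_tuples G"

definition conjugacy_classes :: "('a, 'b) monoid_scheme \<Rightarrow> 'a set set" where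
  "conjugacy_classes G = orbits G (carrier G) (\<lambda>g h. g \<otimes>\<^bsub>G\<^esub> h \<otimes>\<^bsub>G\<^esub> inv\<^bsub>G\<^esub> g)"

definition branches :: "('a, 'b) monoid_scheme \<Rightarrow> 'a list \<Rightarrow> 'a set set" where
  "branches G gs = conjugacy_classes (centralizer G gs)"

text \<open>The type of \<open>gs @ [h]\<close> does not depend on the choice of \<open>h\<close> in the branch \<open>b\<close>
  (see \<open>type_of_branch\<close> below).\<close>

definition branches_of_type :: "('a, 'b) monoid_scheme \<Rightarrow> 'a list set \<Rightarrow> 'a list \<Rightarrow> 'a set set" where
  "branches_of_type G s gs = {b \<in> branches G gs. \<forall>h\<in>b. type_of_tuple G (gs @ [h]) = s}"

text \<open>The entry in row \<open>s\<close> and column \<open>t\<close>. Lemma \<open>branching_matrix_eq\<close> below shows that the number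
  does not depend on the tuple of type \<open>t\<close>.\<close>

definition branching_matrix ::
    "('a, 'b) monoid_scheme \<Rightarrow> 'a list set \<Rightarrow> 'a list set \<Rightarrow> nat" where
  "branching_matrix G s t = (THE n. \<forall>gs\<in>t. card (branches_of_type G s gs) = n)"


section \<open>Well-definedness\<close>

lemma carrier_centralizer:
  "carrier (centralizer G gs) = {z \<in> carrier G. \<forall>g\<in>set gs. z \<otimes>\<^bsub>G\<^esub> g = g \<otimes>\<^bsub>G\<^esub> z}"
  by (simp add: centralizer_def)

lemma mult_centralizer [simp]: "mult (centralizer G gs) = mult G"
  by (simp add: centralizer_def)

lemma centralizer_append:
  "centralizer G (gs @ hs) = centralizer (centralizer G gs) hs"
  by (auto simp: centralizer_def intro!: monoid.equality)

context group
begin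

lemma subgroup_centralizer:
  assumes "set gs \<subseteq> carrier G"
  shows "subgroup (carrier (centralizer G gs)) G"
proof
  show "carrier (centralizer G gs) \<subseteq> carrier G"
    by (auto simp: carrier_centralizer)
  show "\<one> \<in> carrier (centralizer G gs)"
    using assms by (auto simp: carrier_centralizer)
next
  fix x y assume x: "x \<in> carrier (centralizer G gs)" and y: "y \<in> carrier (centralizer G gs)"
  have "x \<otimes> y \<otimes> g = g \<otimes> (x \<otimes> y)" if "g \<in> set gs" for g
  proof -
    have g: "g \<in> carrier G" using that assms by blast
    have xy: "x \<in> carrier G" "y \<in> carrier G" "x \<otimes> g = g \<otimes> x" "y \<otimes> g = g \<otimes> y"
      using x y that by (auto simp: carrier_centralizer)
    then show ?thesis using g by (metis m_assoc)
  qed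
  then show "x \<otimes> y \<in> carrier (centralizer G gs)"
    using x y by (auto simp: carrier_centralizer)
next
  fix x assume x: "x \<in> carrier (centralizer G gs)"
  have "inv x \<otimes> g = g \<otimes> inv x" if "g \<in> set gs" for g
  proof -
    have g: "g \<in> carrier G" using that assms by blast
    have "x \<in> carrier G" "x \<otimes> g = g \<otimes> x"
      using x that by (auto simp: carrier_centralizer)
    then show ?thesis using g
      by (metis inv_closed m_assoc m_closed r_inv l_inv l_one r_one)
  qed
  then show "inv x \<in> carrier (centralizer G gs)"
    using x by (auto simp: carrier_centralizer)
qed

lemma group_centralizer:
  assumes "set gs \<subseteq> carrier G"
  shows "group (centralizer G gs)"
proof -
  have "centralizer G gs = G\<lparr>carrier := carrier (centralizer G gs)\<rparr>"
    by (simp add: centralizer_def)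
  then show ?thesis
    using subgroup_imp_group[OF subgroup_centralizer[OF assms]] by metis
qed

lemma conjugacy_classes_subset:
  "b \<in> conjugacy_classes G \<Longrightarrow> b \<subseteq> carrier G"
  by (auto simp: conjugacy_classes_def orbits_def orbit_def)

lemma type_of_tuple_eq_iff:
  assumes "gs \<in> commuting_tuples G" "hs \<in> commuting_tuples G"
  shows "type_of_tuple G gs = type_of_tuple G hs \<longleftrightarrow> centralizer G gs \<cong> centralizer G hs"
proof
  assume "type_of_tuple G gs = type_of_tuple G hs"
  moreover have "gs \<in> type_of_tuple G gs"
    using assms iso_refl by (auto simp: type_of_tuple_def type_given_by_def)
  ultimately show "centralizer G gs \<cong> centralizer G hs"
    by (auto simp: type_of_tuple_def type_given_by_def)
next
  assume *: "centralizer G gs \<cong> centralizer G hs"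
  have "group (centralizer G gs)"
    using assms group_centralizer by (auto simp: commuting_tuples_def)
  then have "centralizer G hs \<cong> centralizer G gs"
    using * group.iso_sym by blast
  then show "type_of_tuple G gs = type_of_tuple G hs"
    unfolding type_of_tuple_def type_given_by_def using * by (meson iso_trans)
qed

lemma commuting_tuples_append:
  assumes "gs \<in> commuting_tuples G" "h \<in> carrier (centralizer G gs)"
  shows "gs @ [h] \<in> commuting_tuples G"
  using assms by (auto simp: commuting_tuples_def carrier_centralizer)

end

lemma iso_centralizer:
  assumes "\<phi> \<in> iso G H" "h \<in> carrier G" and G: "group G"
  shows "\<phi> \<in> iso (centralizer G [h]) (centralizer H [\<phi> h])"
proof -
  have hom: "\<And>x y. x \<in> carrier G \<Longrightarrow> y \<in> carrier G \<Longrightarrow> \<phi> (x \<otimes>\<^bsub>G\<^esub> y) = \<phi> x \<otimes>\<^bsub>H\<^esub> \<phi> y"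
    and inj: "inj_on \<phi> (carrier G)" and im: "\<phi> ` carrier G = carrier H"
    using assms(1) by (auto simp: iso_def hom_def bij_betw_def)
  have "\<phi> ` carrier (centralizer G [h]) = carrier (centralizer H [\<phi> h])"
  proof
    show "\<phi> ` carrier (centralizer G [h]) \<subseteq> carrier (centralizer H [\<phi> h])"
      using im assms(2) by (auto simp: carrier_centralizer hom[symmetric])
    show "carrier (centralizer H [\<phi> h]) \<subseteq> \<phi> ` carrier (centralizer G [h])"
    proof
      fix y assume y: "y \<in> carrier (centralizer H [\<phi> h])"
      then obtain x where x: "x \<in> carrier G" "y = \<phi> x"
        using im by (auto simp: carrier_centralizer)
      have "y \<otimes>\<^bsub>H\<^esub> \<phi> h = \<phi> h \<otimes>\<^bsub>H\<^esub> y" using y by (simp add: carrier_centralizer)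
      then have "\<phi> (x \<otimes>\<^bsub>G\<^esub> h) = \<phi> (h \<otimes>\<^bsub>G\<^esub> x)" using x assms(2) hom by simp
      moreover have "x \<otimes>\<^bsub>G\<^esub> h \<in> carrier G \<and> h \<otimes>\<^bsub>G\<^esub> x \<in> carrier G"
        using G x assms(2) by (simp add: group.subgroup_self subgroup.m_closed)
      ultimately show "y \<in> \<phi> ` carrier (centralizer G [h])"
        using x inj by (auto simp: carrier_centralizer inj_on_def)
    qed
  qed
  moreover have "inj_on \<phi> (carrier (centralizer G [h]))"
    using inj by (rule inj_on_subset) (auto simp: carrier_centralizer)
  ultimately show ?thesis
    unfolding iso_def hom_def bij_betw_def
    using hom by (auto simp: carrier_centralizer)
qed

lemma (in group) iso_conjugation:
  assumes "x \<in> carrier G"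
  shows "(\<lambda>h. x \<otimes> h \<otimes> inv x) \<in> iso G G"
proof -
  have "bij_betw (\<lambda>h. x \<otimes> h \<otimes> inv x) (carrier G) (carrier G)"
    using conjugation_is_bij[OF assms] by (simp add: bij_betw_restrict_eq)
  moreover have "x \<otimes> (h \<otimes> k) \<otimes> inv x = (x \<otimes> h \<otimes> inv x) \<otimes> (x \<otimes> k \<otimes> inv x)"
    if "h \<in> carrier G" "k \<in> carrier G" for h k
  proof -
    have "inv x \<otimes> (x \<otimes> (k \<otimes> inv x)) = k \<otimes> inv x"
      using that assms by (metis inv_closed l_inv l_one m_assoc m_closed)
    then show ?thesis using that assms by (simp add: m_assoc)
  qed
  ultimately show ?thesis
    using assms by (auto simp: iso_def hom_def)
qed

lemma conjugacy_classes_image: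
  assumes "\<phi> \<in> iso G H" "group G" "group H"
  shows "conjugacy_classes H = (`) \<phi> ` conjugacy_classes G"
proof -
  interpret group_hom G H \<phi>
    using assms by (simp add: group_hom_def group_hom_axioms_def iso_def)
  have im: "carrier H = \<phi> ` carrier G"
    using assms(1) by (auto simp: iso_def bij_betw_def)
  have orb: "orbit H (\<lambda>g h. g \<otimes>\<^bsub>H\<^esub> h \<otimes>\<^bsub>H\<^esub> inv\<^bsub>H\<^esub> g) (\<phi> x) =
      \<phi> ` orbit G (\<lambda>g h. g \<otimes>\<^bsub>G\<^esub> h \<otimes>\<^bsub>G\<^esub> inv\<^bsub>G\<^esub> g) x" if "x \<in> carrier G" for x
  proof -
    have "\<phi> (g \<otimes>\<^bsub>G\<^esub> x \<otimes>\<^bsub>G\<^esub> inv\<^bsub>G\<^esub> g) = \<phi> g \<otimes>\<^bsub>H\<^esub> \<phi> x \<otimes>\<^bsub>H\<^esub> inv\<^bsub>H\<^esub> (\<phi> g)" if "g \<in> carrier G" for g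
      using \<open>x \<in> carrier G\<close> that by simp
    then show ?thesis
      unfolding orbit_def im Setcompr_eq_image image_image by (intro image_cong) auto
  qed
  show ?thesis
    unfolding conjugacy_classes_def orbits_def im Setcompr_eq_image image_image
    by (intro image_cong refl orb)
qed

context group
begin

lemma type_of_branch:
  assumes "gs \<in> commuting_tuples G" "b \<in> branches G gs" "h \<in> b" "k \<in> b"
  shows "type_of_tuple G (gs @ [h]) = type_of_tuple G (gs @ [k])"
proof -
  define Z where "Z = centralizer G gs"
  interpret Z: group Z
    unfolding Z_def using assms(1) group_centralizer by (auto simp: commuting_tuples_def)
  have b: "b \<in> conjugacy_classes Z"
    using assms(2) by (simp add: branches_def Z_def)
  then obtain y where y: "y \<in> carrier Z"
      and b_eq: "b = {x \<otimes>\<^bsub>Z\<^esub> y \<otimes>\<^bsub>Z\<^esub> inv\<^bsub>Z\<^esub> x | x. x \<in> carrier Z}"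
    by (auto simp: conjugacy_classes_def orbits_def orbit_def)
  have *: "type_of_tuple G (gs @ [y]) = type_of_tuple G (gs @ [h])" if hb: "h \<in> b" for h
  proof -
    obtain x where x: "x \<in> carrier Z" "h = x \<otimes>\<^bsub>Z\<^esub> y \<otimes>\<^bsub>Z\<^esub> inv\<^bsub>Z\<^esub> x"
      using hb unfolding b_eq by blast
    then have h: "h \<in> carrier Z" using y by simp
    have "centralizer Z [y] \<cong> centralizer Z [h]"
      using iso_centralizer[OF Z.iso_conjugation[OF x(1)] y Z.is_group] x(2)
      by (auto simp: is_iso_def)
    then have "centralizer G (gs @ [y]) \<cong> centralizer G (gs @ [h])"
      by (simp add: centralizer_append Z_def)
    then show ?thesis
      using type_of_tuple_eq_iff commuting_tuples_append[OF assms(1)] y h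
      by (simp add: Z_def)
  qed
  show ?thesis using *[OF assms(3)] *[OF assms(4)] by simp
qed

lemma card_branches_of_type_eq:
  assumes "gs \<in> commuting_tuples G" "hs \<in> commuting_tuples G"
    and "type_of_tuple G gs = type_of_tuple G hs"
  shows "card (branches_of_type G s gs) = card (branches_of_type G s hs)"
proof -
  have grp: "group (centralizer G gs)" "group (centralizer G hs)"
    using assms(1,2) by (simp_all add: group_centralizer commuting_tuples_def)
  obtain \<phi> where \<phi>: "\<phi> \<in> iso (centralizer G gs) (centralizer G hs)"
    using assms(3) unfolding type_of_tuple_eq_iff[OF assms(1,2)] by (auto simp: is_iso_def)
  have im: "branches G hs = (`) \<phi> ` branches G gs"
    unfolding branches_def by (rule conjugacy_classes_image[OF \<phi> grp])
  have sub: "b \<subseteq> carrier (centralizer G gs)" if "b \<in> branches G gs" for b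
    using that group.conjugacy_classes_subset[OF grp(1)] by (simp add: branches_def)
  have typ_eq: "type_of_tuple G (hs @ [\<phi> h]) = type_of_tuple G (gs @ [h])"
    if "h \<in> carrier (centralizer G gs)" for h
  proof -
    have \<phi>h: "\<phi> h \<in> carrier (centralizer G hs)"
      using \<phi> that by (auto simp: iso_def hom_def)
    have "centralizer G (gs @ [h]) \<cong> centralizer G (hs @ [\<phi> h])"
      using iso_centralizer[OF \<phi> that grp(1)] by (auto simp: is_iso_def centralizer_append)
    then show ?thesis
      using type_of_tuple_eq_iff[OF commuting_tuples_append[OF assms(1) that]
          commuting_tuples_append[OF assms(2) \<phi>h]] by simp
  qed
  have same: "(\<forall>k\<in>\<phi> ` b. type_of_tuple G (hs @ [k]) = s) \<longleftrightarrow>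
      (\<forall>h\<in>b. type_of_tuple G (gs @ [h]) = s)" if "b \<in> branches G gs" for b
    unfolding ball_simps(9) using typ_eq sub[OF that] by (metis subsetD)
  have "branches_of_type G s hs = (`) \<phi> ` branches_of_type G s gs"
    unfolding branches_of_type_def im Compr_image_eq by (simp only: same cong: conj_cong)
  moreover have "inj_on ((`) \<phi>) (branches_of_type G s gs)"
  proof (rule inj_on_subset)
    show "inj_on ((`) \<phi>) (Pow (carrier (centralizer G gs)))"
      using \<phi> by (intro inj_on_image_Pow) (simp add: iso_def bij_betw_def)
    show "branches_of_type G s gs \<subseteq> Pow (carrier (centralizer G gs))"
      unfolding branches_of_type_def using sub by blast
  qed
  ultimately show ?thesis by (simp add: card_image)
qed

lemma branching_matrix_eq:
  assumes "gs \<in> commuting_tuples G"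
  shows "branching_matrix G s (type_of_tuple G gs) = card (branches_of_type G s gs)"
proof -
  have self: "gs \<in> type_of_tuple G gs"
    using assms iso_refl by (auto simp: type_of_tuple_def type_given_by_def)
  have "card (branches_of_type G s hs) = card (branches_of_type G s gs)"
    if "hs \<in> type_of_tuple G gs" for hs
  proof -
    have "hs \<in> commuting_tuples G" "centralizer G hs \<cong> centralizer G gs"
      using that by (auto simp: type_of_tuple_def type_given_by_def)
    then show ?thesis
      using type_of_tuple_eq_iff[of hs gs] assms card_branches_of_type_eq[of hs gs] by simp
  qed
  then show ?thesis
    unfolding branching_matrix_def
  proof (intro the_equality ballI)
    fix n assume "\<forall>hs\<in>type_of_tuple G gs. card (branches_of_type G s hs) = n"
    from bspec[OF this self] show "n = card (branches_of_type G s gs)" by (rule sym)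
  qed
qed

end


section \<open>The group of upper unitriangular matrices\<close>

text \<open>The entries are listed explicitly because the order of the index type \<open>3\<close> is that of the
  residues modulo 3, in which \<open>3 = 0\<close> is the least element.\<close>

definition UT3 :: "('a::field^3^3) monoid" where
  "UT3 = \<lparr>carrier = {vector [vector [1, a, c],
                              vector [0, 1, b],
                              vector [0, 0, 1]] | a b c. True},
          mult = (**), one = mat 1\<rparr>"

definition UT3_R :: "('a::field^3^3) monoid" where
  "UT3_R = UT3\<lparr>carrier := {vector [vector [1, x0, x1],
                                     vector [0, 1, 0],
                                     vector [0, 0, 1]] | x0 x1. True}\<rparr>"

definition type_C :: "('a::field^3^3) list set" where
  "type_C = type_given_by UT3 (UT3 :: ('a^3^3) monoid)"

definition type_R :: "('a::field^3^3) list set" where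
  "type_R = type_given_by UT3 (UT3_R :: ('a^3^3) monoid)"

end

theory Submission
  imports Defs "HOL-Number_Theory.Residues"
begin

text \<open>
  Write \<open>unitri a b c\<close> for the unitriangular matrix with entries \<open>a\<close>, \<open>b\<close> above the diagonal and
  \<open>c\<close> in the corner. Two such matrices commute iff the vectors \<open>(a, b)\<close> are linearly dependent,
  so the centre consists of the \<open>unitri 0 0 c\<close>, and once a commuting tuple contains a noncentral
  element, with vector \<open>(a, b) \<noteq> 0\<close>, all vectors of its entries and of its centralizer lie on the
  line through \<open>(a, b)\<close>. Hence the centralizer of a commuting tuple is either the whole group or
  the abelian group of the \<open>unitri (t * a) (t * b) z\<close>. The latter is isomorphic to \<open>UT3_R\<close> by
  completing the square, which needs \<open>2 \<noteq> 0\<close> in the field; this is where odd order enters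
  (\<open>UT3_R_iso_centralizer\<close>). The whole group is not abelian, so there are exactly two types
  (\<open>tuple_types_UT3\<close>).

  Each column of the branching matrix can be counted at one chosen tuple. For type \<open>R\<close>, the
  centralizer is abelian: its classes are singletons, and appending an element does not shrink it,
  so all \<open>q\<^sup>2\<close> branches again have type \<open>R\<close>. For type \<open>C\<close>, the
  branches are the conjugacy classes of the group. Conjugation fixes \<open>(a, b)\<close> and moves \<open>c\<close> by
  the values of a nonzero linear form when \<open>(a, b) \<noteq> 0\<close>, so there are \<open>q\<close> central singletons, of
  type \<open>C\<close>, and \<open>q\<^sup>2 - 1\<close> full cosets of the centre, of type \<open>R\<close>.
\<close>

section \<open>Coordinates on the unitriangular group\<close>

definition unitri :: "'a::field \<Rightarrow> 'a \<Rightarrow> 'a \<Rightarrow> 'a^3^3" where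
  "unitri a b c = vector [vector [1, a, c], vector [0, 1, b], vector [0, 0, 1]]"

lemma unitri_entries [simp]:
  "unitri a b c $ 1 $ 2 = a" "unitri a b c $ 2 $ 3 = b" "unitri a b c $ 1 $ 3 = c"
  by (simp_all add: unitri_def)

lemma unitri_eq_iff [simp]:
  "unitri a b c = unitri a' b' c' \<longleftrightarrow> a = a' \<and> b = b' \<and> c = c'"
  by (metis unitri_entries)

lemma unitri_mult [simp]:
  "unitri a b c ** unitri a' b' c' = unitri (a + a') (b + b') (c + c' + a * b')"
  by (simp add: unitri_def vec_eq_iff forall_3 matrix_matrix_mult_def sum_3)

lemma mat_1_eq_unitri: "mat 1 = unitri 0 0 0"
  by (simp add: unitri_def vec_eq_iff forall_3 mat_def)

lemma carrier_UT3: "carrier UT3 = {unitri a b c | a b c. True}"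
  by (simp add: UT3_def unitri_def)

lemma carrier_UT3_range: "carrier UT3 = range (\<lambda>(a, b, c). unitri a b c)"
  by (auto simp: carrier_UT3 image_iff)

lemma unitri_in_UT3 [simp]: "unitri a b c \<in> carrier UT3"
  by (auto simp: carrier_UT3)

lemma mult_UT3 [simp]: "x \<otimes>\<^bsub>UT3\<^esub> y = x ** y"
  and one_UT3: "\<one>\<^bsub>UT3\<^esub> = unitri 0 0 0"
  by (simp_all add: UT3_def mat_1_eq_unitri)

lemma UT3_E:
  assumes "g \<in> carrier UT3"
  obtains a b c where "g = unitri a b c"
  using assms by (auto simp: carrier_UT3)

lemma group_UT3: "group (UT3 :: ('a::field^3^3) monoid)"
proof (rule groupI)
  fix x :: "'a^3^3" assume "x \<in> carrier UT3"
  then obtain a b c where x: "x = unitri a b c" by (rule UT3_E)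
  have "unitri (- a) (- b) (a * b - c) \<otimes>\<^bsub>UT3\<^esub> x = \<one>\<^bsub>UT3\<^esub>"
    by (simp add: x one_UT3)
  then show "\<exists>y\<in>carrier UT3. y \<otimes>\<^bsub>UT3\<^esub> x = \<one>\<^bsub>UT3\<^esub>"
    by (rule bexI) simp
qed (auto simp: carrier_UT3 one_UT3 algebra_simps)

interpretation UT3: group "UT3 :: ('a::field^3^3) monoid"
  by (rule group_UT3)

lemma inv_unitri: "inv\<^bsub>UT3\<^esub> (unitri a b c) = unitri (- a) (- b) (a * b - c)"
  by (rule UT3.inv_equality) (simp_all add: one_UT3)

lemma UT3_conjugate:
  "unitri x y z \<otimes>\<^bsub>UT3\<^esub> unitri a b c \<otimes>\<^bsub>UT3\<^esub> inv\<^bsub>UT3\<^esub> (unitri x y z)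
     = unitri a b (c + x * b - a * y)"
  by (simp add: inv_unitri algebra_simps)

lemma unitri_commute_iff:
  "unitri a b c ** unitri a' b' c' = unitri a' b' c' ** unitri a b c \<longleftrightarrow> a * b' = a' * b"
  by (auto simp: algebra_simps)

section \<open>Centralizers of commuting tuples\<close>

lemma centralizer_unitri:
  "carrier (centralizer UT3 [unitri a b c]) = {unitri x y z | x y z. x * b = a * y}"
  by (auto simp: carrier_centralizer carrier_UT3 unitri_commute_iff)

lemma centralizer_central_tuple:
  assumes "\<And>g. g \<in> set gs \<Longrightarrow> \<exists>c. g = unitri 0 0 c"
  shows "centralizer UT3 gs = UT3"
proof -
  have "x ** g = g ** x" if "x \<in> carrier UT3" "g \<in> set gs" for x g
    using that assms[OF that(2)] by (auto simp: carrier_UT3)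
  then have "{z \<in> carrier UT3. \<forall>g\<in>set gs. z \<otimes>\<^bsub>UT3\<^esub> g = g \<otimes>\<^bsub>UT3\<^esub> z} = carrier UT3"
    by auto
  then show ?thesis
    by (simp add: centralizer_def)
qed

text \<open>Two elements that both commute with a noncentral element commute with each other: linear
  dependence of vectors in the plane is transitive through a nonzero vector. One noncentral entry
  therefore determines the centralizer of the tuple.\<close>

lemma centralizer_noncentral_tuple:
  assumes gs: "gs \<in> commuting_tuples UT3" "unitri a b c \<in> set gs" and ab: "a \<noteq> 0 \<or> b \<noteq> 0"
  shows "centralizer UT3 gs = centralizer UT3 [unitri a b c]"
proof -
  have "z ** g = g ** z"
    if z: "z \<in> carrier UT3" "z ** unitri a b c = unitri a b c ** z" and g: "g \<in> set gs" for z g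
  proof -
    obtain x y w where zu: "z = unitri x y w" using z(1) by (rule UT3_E)
    have "g \<in> carrier UT3" using gs(1) g by (auto simp: commuting_tuples_def)
    then obtain a' b' c' where gu: "g = unitri a' b' c'" by (rule UT3_E)
    have "g ** unitri a b c = unitri a b c ** g"
      using gs g by (auto simp: commuting_tuples_def)
    then have 1: "a' * b = a * b'" by (simp add: gu unitri_commute_iff)
    have 2: "x * b = a * y" using z(2) by (simp add: zu unitri_commute_iff)
    have "x * b' = a' * y"
    proof (cases "a = 0")
      case True
      then show ?thesis using 1 2 ab by simp
    next
      case False
      then have "b' = a' * b / a" "y = x * b / a"
        using 1 2 by (simp_all add: field_simps)
      then show ?thesis by simp
    qed
    then show ?thesis by (simp add: zu gu unitri_commute_iff)
  qed
  then have "{z \<in> carrier UT3. \<forall>g\<in>set gs. z \<otimes>\<^bsub>UT3\<^esub> g = g \<otimes>\<^bsub>UT3\<^esub> z}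
      = {z \<in> carrier UT3. \<forall>g\<in>set [unitri a b c]. z \<otimes>\<^bsub>UT3\<^esub> g = g \<otimes>\<^bsub>UT3\<^esub> z}"
    using gs(2) by auto
  then show ?thesis
    by (simp add: centralizer_def)
qed

text \<open>This exhibits \<open>UT3_R\<close> as the centralizer of a concrete tuple, which then serves as the
  representative of type \<open>R\<close>.\<close>

lemma UT3_R_eq_centralizer: "UT3_R = centralizer UT3 [unitri 1 0 0]"
proof (rule monoid.equality)
  show "carrier UT3_R = carrier (centralizer UT3 [unitri 1 0 0])"
    unfolding centralizer_unitri by (auto simp: UT3_R_def unitri_def)
qed (simp_all add: UT3_R_def centralizer_def)

lemma carrier_UT3_R: "carrier UT3_R = {unitri t 0 z | t z. True}"
  unfolding UT3_R_eq_centralizer centralizer_unitri by auto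

lemma mult_UT3_R [simp]: "x \<otimes>\<^bsub>UT3_R\<^esub> y = x ** y"
  by (simp add: UT3_R_def)

lemma two_neq_zero_of_odd_card:
  assumes "odd CARD('a::{field,finite})"
  shows "(2::'a) \<noteq> 0"
proof
  assume "(2::'a) = 0"
  then have "CHAR('a) dvd 2" by (metis of_nat_eq_0_iff_char_dvd of_nat_numeral)
  moreover have "CHAR('a) \<noteq> 1"
    using of_nat_CHAR[where 'a='a] by (metis of_nat_1 zero_neq_one)
  ultimately have "CHAR('a) = 2"
    using two_is_prime_nat prime_nat_iff by blast
  then show False using assms CHAR_dvd_CARD[where 'a='a] by simp
qed

text \<open>In the group of the \<open>unitri (t * a) (t * b) z\<close> the corner entries of two factors add up with
  the cocycle \<open>t * t' * a * b\<close>. As \<open>2 \<noteq> 0\<close>, this is the coboundary of \<open>t\<^sup>2 * a * b / 2\<close>, so shifting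
  the corner entry by that amount turns the multiplication into addition of pairs.\<close>

lemma UT3_R_iso_centralizer:
  fixes a b c :: "'a::field"
  assumes two: "(2::'a) \<noteq> 0" and ab: "a \<noteq> 0 \<or> b \<noteq> 0"
  shows "(UT3_R :: ('a^3^3) monoid) \<cong> centralizer UT3 [unitri a b c]"
proof -
  define \<phi> where "\<phi> g = (let t = g $ 1 $ 2 in unitri (t * a) (t * b) (g $ 1 $ 3 + t^2 * a * b / 2))"
    for g :: "'a^3^3"
  have "(2::'a) * 2 \<noteq> 0"
    using two by (metis mult_eq_0_iff)
  then have four: "(4::'a) \<noteq> 0"
    by simp
  have \<phi>: "\<phi> (unitri t s z) = unitri (t * a) (t * b) (z + t^2 * a * b / 2)" for t s z
    by (simp add: \<phi>_def)
  have "\<phi> \<in> hom UT3_R (centralizer UT3 [unitri a b c])"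
  proof (rule homI)
    fix g assume "g \<in> carrier (UT3_R :: ('a^3^3) monoid)"
    then show "\<phi> g \<in> carrier (centralizer UT3 [unitri a b c])"
      by (auto simp: carrier_UT3_R centralizer_unitri \<phi>)
  next
    fix g h assume "g \<in> carrier (UT3_R :: ('a^3^3) monoid)" "h \<in> carrier (UT3_R :: ('a^3^3) monoid)"
    then show "\<phi> (g \<otimes>\<^bsub>UT3_R\<^esub> h) = \<phi> g \<otimes>\<^bsub>centralizer UT3 [unitri a b c]\<^esub> \<phi> h"
      using two four by (auto simp: carrier_UT3_R \<phi> field_simps power2_eq_square)
  qed
  moreover have "inj_on \<phi> (carrier UT3_R)"
    using ab by (auto simp: inj_on_def carrier_UT3_R \<phi>)
  moreover have "\<phi> ` carrier UT3_R = carrier (centralizer UT3 [unitri a b c])"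
  proof
    show "\<phi> ` carrier UT3_R \<subseteq> carrier (centralizer UT3 [unitri a b c])"
      by (auto simp: carrier_UT3_R centralizer_unitri \<phi>)
    show "carrier (centralizer UT3 [unitri a b c]) \<subseteq> \<phi> ` carrier UT3_R"
    proof
      fix g assume "g \<in> carrier (centralizer UT3 [unitri a b c])"
      then obtain x y z where g: "g = unitri x y z" and xy: "x * b = a * y"
        by (auto simp: centralizer_unitri)
      \<comment> \<open>the coordinate of \<open>(x, y)\<close> on the line through \<open>(a, b)\<close>\<close>
      define t where "t = (if a = 0 then y / b else x / a)"
      have "x = t * a" "y = t * b"
        using ab xy by (auto simp: t_def field_simps)
      then have "g = \<phi> (unitri t 0 (z - t^2 * a * b / 2))"
        by (simp add: g \<phi>)
      then show "g \<in> \<phi> ` carrier UT3_R"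
        by (auto simp: carrier_UT3_R)
    qed
  qed
  ultimately show ?thesis
    unfolding is_iso_def iso_def bij_betw_def by blast
qed

section \<open>The two types\<close>

lemma singleton_commuting_tuple [simp]: "[unitri a b c] \<in> commuting_tuples UT3"
  by (simp add: commuting_tuples_def)

lemma type_of_central_tuple:
  assumes "\<And>g. g \<in> set gs \<Longrightarrow> \<exists>c. g = unitri 0 0 c"
  shows "type_of_tuple UT3 gs = type_C"
  by (simp add: type_of_tuple_def type_C_def centralizer_central_tuple[OF assms])

lemma type_of_noncentral_tuple:
  fixes a b c :: "'a::field"
  assumes "(2::'a) \<noteq> 0" "gs \<in> commuting_tuples UT3" "unitri a b c \<in> set gs" "a \<noteq> 0 \<or> b \<noteq> 0"
  shows "type_of_tuple UT3 gs = type_R"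
proof -
  have "centralizer UT3 [unitri 1 0 (0::'a)] \<cong> centralizer UT3 gs"
    using UT3_R_iso_centralizer[OF assms(1,4)] centralizer_noncentral_tuple[OF assms(2-4)]
    by (simp add: UT3_R_eq_centralizer)
  then have "type_of_tuple UT3 [unitri 1 0 0] = type_of_tuple UT3 gs"
    using assms(2) by (simp add: UT3.type_of_tuple_eq_iff)
  then show ?thesis
    by (simp add: type_R_def type_of_tuple_def UT3_R_eq_centralizer)
qed

lemma type_C_eq: "type_C = type_of_tuple UT3 [unitri 0 0 0]"
  by (rule type_of_central_tuple[symmetric]) simp

lemma type_R_eq: "type_R = type_of_tuple UT3 [unitri 1 0 0]"
  by (simp add: type_R_def type_of_tuple_def UT3_R_eq_centralizer)

lemma card_UT3_R: "card (carrier (UT3_R :: ('a::{field,finite}^3^3) monoid)) = CARD('a)^2"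
proof -
  have "bij_betw (\<lambda>(t, z). unitri t 0 z) UNIV (carrier (UT3_R :: ('a^3^3) monoid))"
    by (auto simp: bij_betw_def inj_on_def carrier_UT3_R image_iff)
  then show ?thesis
    by (simp add: bij_betw_same_card[symmetric] power2_eq_square)
qed

text \<open>\<open>UT3_R\<close> is abelian and \<open>UT3\<close> is not.\<close>

lemma type_C_neq_type_R: "type_C \<noteq> (type_R :: ('a::field^3^3) list set)"
proof
  assume "type_C = (type_R :: ('a^3^3) list set)"
  then have "(UT3_R :: ('a^3^3) monoid) \<cong> (UT3 :: ('a^3^3) monoid)"
    using centralizer_central_tuple[of "[unitri 0 0 (0::'a)]"]
      UT3.type_of_tuple_eq_iff[of "[unitri 1 0 (0::'a)]" "[unitri 0 0 0]"]
    by (simp add: type_C_eq type_R_eq UT3_R_eq_centralizer)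
  then obtain \<phi> where \<phi>: "\<phi> \<in> iso (UT3_R :: ('a^3^3) monoid) (UT3 :: ('a^3^3) monoid)"
    by (auto simp: is_iso_def)
  have comm: "g ** h = h ** g" if gh: "g \<in> carrier UT3" "h \<in> carrier UT3" for g h :: "'a^3^3"
  proof -
    obtain g' h' where "g' \<in> carrier UT3_R" "h' \<in> carrier UT3_R" "g = \<phi> g'" "h = \<phi> h'"
      using \<phi> gh unfolding iso_def bij_betw_def by blast
    moreover from this have "g' \<otimes>\<^bsub>UT3_R\<^esub> h' = h' \<otimes>\<^bsub>UT3_R\<^esub> g'"
      by (auto simp: carrier_UT3_R)
    ultimately show ?thesis
      using \<phi> by (metis hom_mult iso_imp_homomorphism mult_UT3)
  qed
  have "unitri 1 0 0 ** unitri 0 1 0 = unitri 0 1 0 ** unitri 1 0 (0::'a)"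
    by (rule comm) simp_all
  then show False by (simp add: unitri_commute_iff)
qed

lemma tuple_types_UT3:
  assumes "(2::'a::field) \<noteq> 0"
  shows "tuple_types (UT3 :: ('a^3^3) monoid) = {type_C, type_R}"
proof -
  have "type_of_tuple UT3 gs \<in> {type_C, type_R}" if gs: "gs \<in> commuting_tuples UT3"
    for gs :: "('a^3^3) list"
  proof (cases "\<forall>g\<in>set gs. \<exists>c. g = unitri 0 0 c")
    case True
    then show ?thesis using type_of_central_tuple by blast
  next
    case False
    then obtain g where g: "g \<in> set gs" "\<nexists>c. g = unitri 0 0 c" by blast
    moreover have "g \<in> carrier UT3" using gs g(1) by (auto simp: commuting_tuples_def)
    ultimately obtain a b c where "unitri a b c \<in> set gs" "a \<noteq> 0 \<or> b \<noteq> 0"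
      by (metis UT3_E)
    then show ?thesis using type_of_noncentral_tuple[OF assms gs] by blast
  qed
  then show ?thesis
    unfolding tuple_types_def type_C_eq type_R_eq by auto
qed

section \<open>Branches and conjugacy classes\<close>

text \<open>An element of an abelian centralizer \<open>Z\<close> is conjugate only to itself in \<open>Z\<close> and is centralized by
  all of \<open>Z\<close>, so appending it to the tuple changes neither the centralizer nor the type.\<close>

lemma (in group) branches_of_type_abelian_centralizer:
  assumes gs: "gs \<in> commuting_tuples G"
    and comm: "\<And>x y. x \<in> carrier (centralizer G gs) \<Longrightarrow> y \<in> carrier (centralizer G gs)
                 \<Longrightarrow> x \<otimes> y = y \<otimes> x"
  shows "branches_of_type G s gs =
    (if s = type_of_tuple G gs then (\<lambda>h. {h}) ` carrier (centralizer G gs) else {})"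
proof -
  define Z where "Z = centralizer G gs"
  interpret Z: group Z
    unfolding Z_def using gs group_centralizer by (auto simp: commuting_tuples_def)
  have Zcomm: "x \<otimes>\<^bsub>Z\<^esub> y = y \<otimes>\<^bsub>Z\<^esub> x" if "x \<in> carrier Z" "y \<in> carrier Z" for x y
    using comm that by (simp add: Z_def)
  have "orbit Z (\<lambda>g h. g \<otimes>\<^bsub>Z\<^esub> h \<otimes>\<^bsub>Z\<^esub> inv\<^bsub>Z\<^esub> g) h = {h}" if h: "h \<in> carrier Z" for h
  proof -
    have "g \<otimes>\<^bsub>Z\<^esub> h \<otimes>\<^bsub>Z\<^esub> inv\<^bsub>Z\<^esub> g = h" if "g \<in> carrier Z" for g
      using that h by (simp add: Zcomm[of g h] Z.m_assoc)
    then show ?thesis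
      using Z.carrier_not_empty by (simp add: orbit_def Setcompr_eq_image image_constant_conv cong: image_cong_simp)
  qed
  then have br: "branches G gs = (\<lambda>h. {h}) ` carrier Z"
    by (auto simp: branches_def conjugacy_classes_def orbits_def Z_def[symmetric])
  have "type_of_tuple G (gs @ [h]) = type_of_tuple G gs" if h: "h \<in> carrier Z" for h
  proof -
    have "{z \<in> carrier Z. \<forall>g\<in>set [h]. z \<otimes>\<^bsub>Z\<^esub> g = g \<otimes>\<^bsub>Z\<^esub> z} = carrier Z"
      using Zcomm h by auto
    then have "centralizer G (gs @ [h]) = Z"
      by (simp add: centralizer_append Z_def[symmetric]) (simp add: centralizer_def)
    then show ?thesis by (simp add: type_of_tuple_def Z_def)
  qed
  then show ?thesis
    by (auto simp: branches_of_type_def br Z_def[symmetric])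
qed

lemma card_branches_type_R:
  "card (branches_of_type UT3 s [unitri 1 0 (0::'a::{field,finite})])
     = (if s = type_R then CARD('a)^2 else 0)"
proof -
  let ?Z = "centralizer UT3 [unitri 1 0 (0::'a)]"
  have "x \<otimes>\<^bsub>UT3\<^esub> y = y \<otimes>\<^bsub>UT3\<^esub> x" if "x \<in> carrier ?Z" "y \<in> carrier ?Z" for x y
    using that by (auto simp: centralizer_unitri)
  from UT3.branches_of_type_abelian_centralizer[OF singleton_commuting_tuple this]
  have "branches_of_type UT3 s [unitri 1 0 0] = (if s = type_R then (\<lambda>h. {h}) ` carrier ?Z else {})"
    by (simp add: type_R_eq)
  then show ?thesis
    by (simp add: card_image card_UT3_R UT3_R_eq_centralizer[symmetric])
qed

text \<open>Conjugation by \<open>unitri x y z\<close> adds \<open>x * b - a * y\<close> to the corner entry. As \<open>(x, y)\<close> varies,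
  this form is identically zero if \<open>(a, b) = 0\<close> and takes every value otherwise.\<close>

lemma UT3_conjugacy_class:
  fixes a b c :: "'a::field"
  shows "orbit UT3 (\<lambda>g h. g \<otimes>\<^bsub>UT3\<^esub> h \<otimes>\<^bsub>UT3\<^esub> inv\<^bsub>UT3\<^esub> g) (unitri a b c)
    = (if a = 0 \<and> b = 0 then {unitri 0 0 c} else range (unitri a b))"
proof -
  have "orbit UT3 (\<lambda>g h. g \<otimes>\<^bsub>UT3\<^esub> h \<otimes>\<^bsub>UT3\<^esub> inv\<^bsub>UT3\<^esub> g) (unitri a b c)
      = range (\<lambda>(x, y, z::'a). unitri a b (c + x * b - a * y))"
    unfolding orbit_def carrier_UT3_range Setcompr_eq_image image_image
    by (simp add: case_prod_unfold UT3_conjugate del: mult_UT3)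
  also have "\<dots> = (if a = 0 \<and> b = 0 then {unitri 0 0 c} else range (unitri a b))"
  proof (cases "a = 0 \<and> b = 0")
    case False
    have *: "\<exists>x y. d = c + x * b - a * y" for d
    proof (cases "b = 0")
      case True
      with False have "d = c + 0 * b - a * ((c - d) / a)" by (simp add: field_simps)
      then show ?thesis by blast
    next
      case False
      then have "d = c + (d - c) / b * b - a * 0" by simp
      then show ?thesis by blast
    qed
    have "unitri a b d \<in> range (\<lambda>(x, y, z::'a). unitri a b (c + x * b - a * y))" for d
      using *[of d] by (auto simp: image_iff)
    then have "range (\<lambda>(x, y, z::'a). unitri a b (c + x * b - a * y)) = range (unitri a b)"
      by auto
    then show ?thesis by (simp only: False if_False)
  qed auto
  finally show ?thesis .
qed

lemma branches_UT3:
  "branches UT3 [unitri 0 0 (0::'a::field)] =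
     range (\<lambda>c. {unitri 0 0 c}) \<union> (\<lambda>(a, b). range (unitri a b)) ` (UNIV - {(0, 0)})"
proof -
  have "branches UT3 [unitri 0 0 (0::'a)] =
      (\<lambda>(a, b, c). if a = 0 \<and> b = 0 then {unitri 0 0 c} else range (unitri a b)) ` UNIV"
    using centralizer_central_tuple[of "[unitri 0 0 (0::'a)]"]
    unfolding branches_def conjugacy_classes_def orbits_def Setcompr_eq_image
    by (simp add: carrier_UT3_range image_image case_prod_unfold UT3_conjugacy_class del: mult_UT3)
  also have "\<dots> = range (\<lambda>c. {unitri 0 0 c})
      \<union> (\<lambda>(a, b). range (unitri a b)) ` (UNIV - {(0, 0)})"
    by (force simp: image_iff)
  finally show ?thesis .
qed

lemma branches_of_type_UT3:
  fixes s :: "('a::field^3^3) list set"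
  assumes "(2::'a) \<noteq> 0"
  shows "branches_of_type UT3 s [unitri 0 0 (0::'a)] =
     (if s = type_C then range (\<lambda>c. {unitri 0 0 c}) else {})
     \<union> (if s = type_R then (\<lambda>(a, b). range (unitri a b)) ` (UNIV - {(0, 0)}) else {})"
proof -
  have C: "type_of_tuple UT3 [unitri 0 0 0, unitri 0 0 c] = type_C" for c :: 'a
    by (rule type_of_central_tuple) auto
  have R: "type_of_tuple UT3 [unitri 0 0 0, unitri a b c] = type_R" if "a \<noteq> 0 \<or> b \<noteq> 0"
    for a b c :: 'a
    by (rule type_of_noncentral_tuple[OF assms _ _ that, of _ c]) (auto simp: commuting_tuples_def)
  \<comment> \<open>The two families are named so that their elements stay opaque in the final case distinction.\<close>
  define centrals where "centrals = range (\<lambda>c::'a. {unitri 0 0 c})"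
  define cosets where "cosets = (\<lambda>(a, b). range (unitri a (b::'a))) ` (UNIV - {(0, 0)})"
  have "(\<forall>h\<in>B. type_of_tuple UT3 ([unitri 0 0 0] @ [h]) = s) \<longleftrightarrow> s = type_C"
    if "B \<in> centrals" for B
    using that by (auto simp: centrals_def C)
  moreover have "(\<forall>h\<in>B. type_of_tuple UT3 ([unitri 0 0 0] @ [h]) = s) \<longleftrightarrow> s = type_R"
    if "B \<in> cosets" for B
    using that by (auto simp: cosets_def R)
  ultimately show ?thesis
    unfolding branches_of_type_def branches_UT3 centrals_def[symmetric] cosets_def[symmetric]
    by (auto split: if_splits)
qed

lemma card_branches_type_C:
  fixes s :: "('a::{field,finite}^3^3) list set"
  assumes "(2::'a) \<noteq> 0"
  shows "card (branches_of_type UT3 type_C [unitri 0 0 (0::'a)]) = CARD('a)"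
    and "card (branches_of_type UT3 type_R [unitri 0 0 (0::'a)]) = CARD('a)^2 - 1"
proof -
  have "inj (\<lambda>c::'a. {unitri 0 0 c})" by (auto simp: inj_on_def)
  then show "card (branches_of_type UT3 type_C [unitri 0 0 (0::'a)]) = CARD('a)"
    using type_C_neq_type_R[where 'a='a] by (simp add: branches_of_type_UT3[OF assms] card_image)
  have "inj (\<lambda>(a, b). range (unitri a (b::'a)))"
  proof (rule injI, clarify)
    fix a b a' b' :: 'a assume "range (unitri a b) = range (unitri a' b')"
    then have "unitri a b 0 \<in> range (unitri a' b')" by blast
    then show "a = a' \<and> b = b'" by auto
  qed
  then have "inj_on (\<lambda>(a, b). range (unitri a (b::'a))) (UNIV - {(0, 0)})"
    by (rule inj_on_subset) simp
  then show "card (branches_of_type UT3 type_R [unitri 0 0 (0::'a)]) = CARD('a)^2 - 1"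
    using type_C_neq_type_R[where 'a='a]
    by (simp add: branches_of_type_UT3[OF assms] card_image card_Diff_singleton power2_eq_square)
qed

theorem theorem5p1:
  fixes q :: nat
  assumes "CARD('a::{field,finite}) = q" and "odd q"
  shows "tuple_types (UT3 :: ('a^3^3) monoid) = {type_C, type_R} \<and>
         type_C \<noteq> (type_R :: ('a^3^3) list set) \<and>
         map (\<lambda>s. map (\<lambda>t. branching_matrix (UT3 :: ('a^3^3) monoid) s t) [type_C, type_R])
             [type_C, type_R] =
           [[q,       0  ],
            [q^2 - 1, q^2]]"
proof -
  have two: "(2::'a) \<noteq> 0"
    using assms by (simp add: two_neq_zero_of_odd_card)
  have "branching_matrix UT3 s type_C = card (branches_of_type UT3 s [unitri 0 0 (0::'a)])"
    and "branching_matrix UT3 s type_R = card (branches_of_type UT3 s [unitri 1 0 (0::'a)])" for s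
    by (simp_all add: type_C_eq type_R_eq UT3.branching_matrix_eq)
  then show ?thesis
    using two assms type_C_neq_type_R[where 'a='a]
    by (simp add: tuple_types_UT3 card_branches_type_C card_branches_type_R)
qed

end
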